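(* There exists an unrealizable constrained LTLf specification $\mathcal{S}=\langle \mathcal{X}, \mathcal{Y}, \alpha, \varphi \rangle$ such that the LTLf specification $\mathcal{S}_\rightarrow = \langle \mathcal{X}, \mathcal{Y}, \alpha \rightarrow \varphi \rangle$ is realizable.
   Context: Let $\mathcal{X}$ (uncontrollable) and $\mathcal{Y}$ (controllable) be disjoint finite sets of propositional variables. LTL formulas are interpreted over infinite words over $2^{\mathcal{X}\cup\mathcal{Y}}$; LTLf formulas have the same syntax but are interpreted over finite traces. An LTLf specification $\langle \mathcal{X}, \mathcal{Y}, \varphi \rangle$ ($\varphi$ an LTLf formula) is realizable if there is a strategy $\sigma: (2^{\mathcal{X}})^* \rightarrow 2^{\mathcal{Y} \cup \{\mathsf{end}\}}$ that, for every infinite sequence $\mathbf{X}=X_1X_2\ldots$ of subsets of $\mathcal{X}$, outputs $\mathsf{end}$ at exactly one step $n$, such that every induced finite trace $(X_1\cup\sigma(X_1))\cdots(X_n\cup\sigma(X_1\cdots X_n))$ (with $\mathsf{end}$ removed) satisfies $\varphi$ under LTLf semantics. A constrained LTLf specification $\langle \mathcal{X}, \mathcal{Y}, \alpha, \varphi \rangle$ has an LTLf objective $\varphi$ and an LTL assumption $\alpha$ interpreted over infinite traces; strategies output $\mathsf{end}$ at most once per $\mathbf{X}$. Such a strategy is an $\alpha$-strategy if, for every $\mathbf{X}$, either it outputs $\mathsf{end}$ at some finite step or the induced infinite trace $(X_1\cup\sigma(X_1))(X_2\cup\sigma(X_1X_2))\cdots$ does not satisfy $\alpha$; it is winning if it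 is an $\alpha$-strategy and all its induced finite traces satisfy $\varphi$. The constrained specification is realizable if a winning strategy exists. In $\mathcal{S}_\rightarrow$, the formula $\alpha\rightarrow\varphi$ is evaluated entirely under LTLf (finite-trace) semantics. *)

theory Defs
  imports Main "HOL-Library.Omega_Words_Fun"
begin

text \<open>The usual temporal operators are derivable from this core under both semantics:
  for instance release is the dual of until, and weak next is the dual of (strong) next.\<close>

datatype (atoms: 'v) ltl =
    TrueL
  | Atom 'v
  | Neg "'v ltl"
  | And "'v ltl" "'v ltl"
  | Next "'v ltl"
  | Until "'v ltl" "'v ltl"

definition Or :: "'v ltl \<Rightarrow> 'v ltl \<Rightarrow> 'v ltl" where
  "Or \<phi> \<psi> = Neg (And (Neg \<phi>) (Neg \<psi>))"

definition Implies :: "'v ltl \<Rightarrow> 'v ltl \<Rightarrow> 'v ltl" where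
  "Implies \<phi> \<psi> = Or (Neg \<phi>) \<psi>"

fun ltl_sat_at :: "'v set word \<Rightarrow> nat \<Rightarrow> 'v ltl \<Rightarrow> bool" where
  "ltl_sat_at w i TrueL \<longleftrightarrow> True"
| "ltl_sat_at w i (Atom p) \<longleftrightarrow> p \<in> w i"
| "ltl_sat_at w i (Neg \<phi>) \<longleftrightarrow> \<not> ltl_sat_at w i \<phi>"
| "ltl_sat_at w i (And \<phi> \<psi>) \<longleftrightarrow> ltl_sat_at w i \<phi> \<and> ltl_sat_at w i \<psi>"
| "ltl_sat_at w i (Next \<phi>) \<longleftrightarrow> ltl_sat_at w (Suc i) \<phi>"
| "ltl_sat_at w i (Until \<phi> \<psi>) \<longleftrightarrow>
     (\<exists>k\<ge>i. ltl_sat_at w k \<psi> \<and> (\<forall>j. i \<le> j \<and> j < k \<longrightarrow> ltl_sat_at w j \<phi>))"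

definition ltl_sat :: "'v set word \<Rightarrow> 'v ltl \<Rightarrow> bool" where
  "ltl_sat w \<phi> \<longleftrightarrow> ltl_sat_at w 0 \<phi>"

text \<open>Positions \<open>i\<close> are meant to satisfy \<open>i < length t\<close>; \<open>Next\<close> is the strong next.\<close>

fun ltlf_sat_at :: "'v set list \<Rightarrow> nat \<Rightarrow> 'v ltl \<Rightarrow> bool" where
  "ltlf_sat_at t i TrueL \<longleftrightarrow> True"
| "ltlf_sat_at t i (Atom p) \<longleftrightarrow> p \<in> t ! i"
| "ltlf_sat_at t i (Neg \<phi>) \<longleftrightarrow> \<not> ltlf_sat_at t i \<phi>"
| "ltlf_sat_at t i (And \<phi> \<psi>) \<longleftrightarrow> ltlf_sat_at t i \<phi> \<and> ltlf_sat_at t i \<psi>"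
| "ltlf_sat_at t i (Next \<phi>) \<longleftrightarrow> Suc i < length t \<and> ltlf_sat_at t (Suc i) \<phi>"
| "ltlf_sat_at t i (Until \<phi> \<psi>) \<longleftrightarrow>
     (\<exists>k\<ge>i. k < length t \<and> ltlf_sat_at t k \<psi> \<and> (\<forall>j. i \<le> j \<and> j < k \<longrightarrow> ltlf_sat_at t j \<phi>))"

definition ltlf_sat :: "'v set list \<Rightarrow> 'v ltl \<Rightarrow> bool" where
  "ltlf_sat t \<phi> \<longleftrightarrow> ltlf_sat_at t 0 \<phi>"

definition ltlf_spec :: "'v set \<Rightarrow> 'v set \<Rightarrow> 'v ltl \<Rightarrow> bool" where
  "ltlf_spec X Y \<phi> \<longleftrightarrow>
     finite X \<and> finite Y \<and> X \<inter> Y = {} \<and> atoms \<phi> \<subseteq> X \<union> Y"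

definition constrained_spec :: "'v set \<Rightarrow> 'v set \<Rightarrow> 'v ltl \<Rightarrow> 'v ltl \<Rightarrow> bool" where
  "constrained_spec X Y \<alpha> \<phi> \<longleftrightarrow>
     finite X \<and> finite Y \<and> X \<inter> Y = {} \<and> atoms \<alpha> \<subseteq> X \<union> Y \<and> atoms \<phi> \<subseteq> X \<union> Y"

datatype 'v signal = Ctrl 'v | End

type_synonym 'v strategy = "'v set list \<Rightarrow> 'v signal set"

definition is_strategy :: "'v set \<Rightarrow> 'v set \<Rightarrow> 'v strategy \<Rightarrow> bool" where
  "is_strategy X Y \<sigma> \<longleftrightarrow> (\<forall>u \<in> lists (Pow X). \<sigma> u \<subseteq> Ctrl ` Y \<union> {End})"

definition inputs :: "'v set \<Rightarrow> 'v set word set" where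
  "inputs X = {xs. \<forall>i. xs i \<subseteq> X}"

text \<open>Steps are counted from 1, whereas words are indexed from 0: at step \<open>n\<close> the strategy
  has read the first \<open>n\<close> inputs, and its output contributes to letter \<open>n - 1\<close> of the trace.\<close>

definition ends_at :: "'v strategy \<Rightarrow> 'v set word \<Rightarrow> nat \<Rightarrow> bool" where
  "ends_at \<sigma> xs n \<longleftrightarrow> n \<ge> 1 \<and> End \<in> \<sigma> (prefix n xs)"

text \<open>Taking the preimage under \<open>Ctrl\<close> removes \<open>End\<close>.\<close>

definition inf_trace :: "'v strategy \<Rightarrow> 'v set word \<Rightarrow> 'v set word" where
  "inf_trace \<sigma> xs = (\<lambda>i. xs i \<union> Ctrl -` \<sigma> (prefix (Suc i) xs))"

definition fin_trace :: "'v strategy \<Rightarrow> 'v set word \<Rightarrow> nat \<Rightarrow> 'v set list" where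
  "fin_trace \<sigma> xs n = prefix n (inf_trace \<sigma> xs)"

definition fin_traces_sat :: "'v set \<Rightarrow> 'v strategy \<Rightarrow> 'v ltl \<Rightarrow> bool" where
  "fin_traces_sat X \<sigma> \<phi> \<longleftrightarrow>
     (\<forall>xs \<in> inputs X. \<forall>n. ends_at \<sigma> xs n \<longrightarrow> ltlf_sat (fin_trace \<sigma> xs n) \<phi>)"

definition ltlf_realizable :: "'v set \<Rightarrow> 'v set \<Rightarrow> 'v ltl \<Rightarrow> bool" where
  "ltlf_realizable X Y \<phi> \<longleftrightarrow>
     (\<exists>\<sigma>. is_strategy X Y \<sigma> \<and> (\<forall>xs \<in> inputs X. \<exists>!n. ends_at \<sigma> xs n) \<and> fin_traces_sat X \<sigma> \<phi>)"

definition alpha_strategy :: "'v set \<Rightarrow> 'v set \<Rightarrow> 'v ltl \<Rightarrow> 'v strategy \<Rightarrow> bool" where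
  "alpha_strategy X Y \<alpha> \<sigma> \<longleftrightarrow>
     is_strategy X Y \<sigma> \<and> (\<forall>xs \<in> inputs X. \<exists>\<^sub>\<le>\<^sub>1n. ends_at \<sigma> xs n) \<and>
     (\<forall>xs \<in> inputs X. (\<exists>n. ends_at \<sigma> xs n) \<or> \<not> ltl_sat (inf_trace \<sigma> xs) \<alpha>)"

definition winning_strategy ::
    "'v set \<Rightarrow> 'v set \<Rightarrow> 'v ltl \<Rightarrow> 'v ltl \<Rightarrow> 'v strategy \<Rightarrow> bool" where
  "winning_strategy X Y \<alpha> \<phi> \<sigma> \<longleftrightarrow> alpha_strategy X Y \<alpha> \<sigma> \<and> fin_traces_sat X \<sigma> \<phi>"

definition constrained_realizable :: "'v set \<Rightarrow> 'v set \<Rightarrow> 'v ltl \<Rightarrow> 'v ltl \<Rightarrow> bool" where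
  "constrained_realizable X Y \<alpha> \<phi> \<longleftrightarrow> (\<exists>\<sigma>. winning_strategy X Y \<alpha> \<phi> \<sigma>)"

end

theory Submission imports Defs begin

text \<open>The assumption \<open>Next TrueL\<close> holds on every infinite trace but fails on every finite trace of
  length 1. With the objective \<open>Neg TrueL\<close>, a winning strategy for the constrained specification
  would have to stop, yet no finite trace satisfies its objective; whereas stopping after one step
  satisfies the implication, by falsifying its premise under finite-trace semantics.\<close>

lemma not_constrained_realizable_Neg_TrueL:
  assumes "\<And>w. ltl_sat w \<alpha>"
  shows "\<not> constrained_realizable X Y \<alpha> (Neg TrueL)"
proof
  assume "constrained_realizable X Y \<alpha> (Neg TrueL)"
  then obtain \<sigma> where "alpha_strategy X Y \<alpha> \<sigma>" and fin: "fin_traces_sat X \<sigma> (Neg TrueL)"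
    unfolding constrained_realizable_def winning_strategy_def by blast
  \<comment> \<open>The conditions on \<sigma> range over \<open>inputs X\<close>, so a concrete
    input is needed; the constant empty one exists for every \<open>X\<close>.\<close>
  moreover have input: "(\<lambda>_. {}) \<in> inputs X"
    by (simp add: inputs_def)
  ultimately obtain n where "ends_at \<sigma> (\<lambda>_. {}) n"
    using assms unfolding alpha_strategy_def by blast
  with fin input show False
    by (auto simp: fin_traces_sat_def ltlf_sat_def)
qed

text \<open>Stopping at the first step, whatever the input, induces only one-letter traces.\<close>

lemma ltlf_realizable_if_singleton_traces_sat:
  assumes "\<And>a. ltlf_sat [a] \<phi>"
  shows "ltlf_realizable X Y \<phi>"
proof -
  \<comment> \<open>Step 1 has already read one input, hence length 1 and not 0; silence on longer
    histories makes \<open>End\<close> occur only once.\<close>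
  define \<sigma> :: "'a strategy" where "\<sigma> u = (if length u = 1 then {End} else {})" for u
  have ends: "ends_at \<sigma> xs n \<longleftrightarrow> n = 1" for xs n
    by (auto simp: ends_at_def \<sigma>_def)
  have "is_strategy X Y \<sigma>"
    by (simp add: is_strategy_def \<sigma>_def)
  moreover have "fin_traces_sat X \<sigma> \<phi>"
    by (simp add: fin_traces_sat_def ends fin_trace_def assms)
  ultimately show ?thesis
    unfolding ltlf_realizable_def using ends by auto
qed

theorem theorem2:
  shows "\<exists>(X :: nat set) (Y :: nat set) (\<alpha> :: nat ltl) (\<phi> :: nat ltl).
    constrained_spec X Y \<alpha> \<phi> \<and> \<not> constrained_realizable X Y \<alpha> \<phi> \<and>
    ltlf_spec X Y (Implies \<alpha> \<phi>) \<and> ltlf_realizable X Y (Implies \<alpha> \<phi>)"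
proof (intro exI conjI)
  \<comment> \<open>Both formulas are free of atoms, so empty variable sets suffice.\<close>
  show "constrained_spec {} {} (Next TrueL) (Neg TrueL)"
    by (simp add: constrained_spec_def)
  show "\<not> constrained_realizable {} {} (Next TrueL) (Neg TrueL)"
    by (rule not_constrained_realizable_Neg_TrueL) (simp add: ltl_sat_def)
  show "ltlf_spec {} {} (Implies (Next TrueL) (Neg TrueL))"
    by (simp add: ltlf_spec_def Implies_def Or_def)
  show "ltlf_realizable {} {} (Implies (Next TrueL) (Neg TrueL))"
    by (rule ltlf_realizable_if_singleton_traces_sat) (simp add: ltlf_sat_def Implies_def Or_def)
qed

end
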